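(* Let $\mathcal{G}$ be a locally compact Hausdorff étale groupoid, let $G$ be a countable discrete abelian group, and let $c\in Z^1(\mathcal{G},G)$. Suppose that $\mathcal{G}$ is minimal and that for all $x\in\mathcal{G}^{(0)}$ the restriction of $c$ to $\mathcal{G}^x_x$ is injective. Let $\mathcal{I}$ denote the interior of the isotropy of $\mathcal{G}$. For $x,y\in\mathcal{G}^{(0)}$ we have $c(\mathcal{I}\cap\mathcal{G}^x_x)=c(\mathcal{I}\cap\mathcal{G}^y_y)$. The set $H$ defined by $H:=c(\mathcal{I}\cap\mathcal{G}^x_x)$ for any $x\in\mathcal{G}^{(0)}$ is a subgroup of $G$, and $s\times c$ induces an isomorphism from $\mathcal{I}$ to $\mathcal{G}^{(0)}\times H$. In particular the interior of the isotropy of $\mathcal{G}$ is closed.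
   Context: An étale groupoid is a topological groupoid (continuous operations) whose range and source maps $r,s:\mathcal{G}\to\mathcal{G}^{(0)}$ are local homeomorphisms. $\mathcal{G}^x_x=\{\gamma:r(\gamma)=s(\gamma)=x\}$; the isotropy of $\mathcal{G}$ is $\bigcup_x\mathcal{G}^x_x$. $\mathcal{G}$ is minimal if $\{r(\gamma):s(\gamma)=u\}$ is dense in $\mathcal{G}^{(0)}$ for every unit $u$. $Z^1(\mathcal{G},G)$ is the set of continuous $1$-cocycles, i.e. continuous maps $c:\mathcal{G}\to G$ with $c(\alpha\beta)=c(\alpha)c(\beta)$ for composable $\alpha,\beta$. $\mathcal{G}^{(0)}\times H$ is regarded as the (group bundle) groupoid with unit space $\mathcal{G}^{(0)}$ and every isotropy group equal to $H$, and $(s\times c)(\gamma)=(s(\gamma),c(\gamma))$. *)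

theory Defs
  imports "HOL-Analysis.Analysis" "HOL-Algebra.Group"
begin

text \<open>
  The unit space is a subset of the arrows, as is usual for topological groupoids, and it carries
  the subspace topology. A product \<open>gmult \<G> a b\<close> is meaningful only if \<open>src \<G> a = rng \<G> b\<close>.
\<close>

record 'g groupoid_data =
  arrow_top :: "'g topology"
  units :: "'g set"
  src :: "'g \<Rightarrow> 'g"
  rng :: "'g \<Rightarrow> 'g"
  gmult :: "'g \<Rightarrow> 'g \<Rightarrow> 'g"
  ginv :: "'g \<Rightarrow> 'g"

definition arrows :: "'g groupoid_data \<Rightarrow> 'g set" where
  "arrows \<G> = topspace (arrow_top \<G>)"

definition unit_top :: "'g groupoid_data \<Rightarrow> 'g topology" where
  "unit_top \<G> = subtopology (arrow_top \<G>) (units \<G>)"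

definition composable :: "'g groupoid_data \<Rightarrow> ('g \<times> 'g) set" where
  "composable \<G> = {(a, b). a \<in> arrows \<G> \<and> b \<in> arrows \<G> \<and> src \<G> a = rng \<G> b}"

locale groupoid =
  fixes \<G> :: "'g groupoid_data"
  assumes units_subset: "units \<G> \<subseteq> arrows \<G>"
    and src_closed: "a \<in> arrows \<G> \<Longrightarrow> src \<G> a \<in> units \<G>"
    and rng_closed: "a \<in> arrows \<G> \<Longrightarrow> rng \<G> a \<in> units \<G>"
    and src_unit: "u \<in> units \<G> \<Longrightarrow> src \<G> u = u"
    and rng_unit: "u \<in> units \<G> \<Longrightarrow> rng \<G> u = u"
    and mult_closed: "(a, b) \<in> composable \<G> \<Longrightarrow> gmult \<G> a b \<in> arrows \<G>"
    and src_mult: "(a, b) \<in> composable \<G> \<Longrightarrow> src \<G> (gmult \<G> a b) = src \<G> b"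
    and rng_mult: "(a, b) \<in> composable \<G> \<Longrightarrow> rng \<G> (gmult \<G> a b) = rng \<G> a"
    and mult_assoc: "(a, b) \<in> composable \<G> \<Longrightarrow> (b, d) \<in> composable \<G> \<Longrightarrow>
      gmult \<G> (gmult \<G> a b) d = gmult \<G> a (gmult \<G> b d)"
    and rng_mult_left: "a \<in> arrows \<G> \<Longrightarrow> gmult \<G> (rng \<G> a) a = a"
    and src_mult_right: "a \<in> arrows \<G> \<Longrightarrow> gmult \<G> a (src \<G> a) = a"
    and inv_closed: "a \<in> arrows \<G> \<Longrightarrow> ginv \<G> a \<in> arrows \<G>"
    and src_inv: "a \<in> arrows \<G> \<Longrightarrow> src \<G> (ginv \<G> a) = rng \<G> a"
    and rng_inv: "a \<in> arrows \<G> \<Longrightarrow> rng \<G> (ginv \<G> a) = src \<G> a"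
    and inv_mult_left: "a \<in> arrows \<G> \<Longrightarrow> gmult \<G> (ginv \<G> a) a = src \<G> a"
    and inv_mult_right: "a \<in> arrows \<G> \<Longrightarrow> gmult \<G> a (ginv \<G> a) = rng \<G> a"

locale topological_groupoid = groupoid +
  assumes continuous_src: "continuous_map (arrow_top \<G>) (unit_top \<G>) (src \<G>)"
    and continuous_rng: "continuous_map (arrow_top \<G>) (unit_top \<G>) (rng \<G>)"
    and continuous_mult:
      "continuous_map (subtopology (prod_topology (arrow_top \<G>) (arrow_top \<G>)) (composable \<G>))
         (arrow_top \<G>) (\<lambda>(a, b). gmult \<G> a b)"
    and continuous_inv: "continuous_map (arrow_top \<G>) (arrow_top \<G>) (ginv \<G>)"

definition local_homeomorphism :: "'a topology \<Rightarrow> 'b topology \<Rightarrow> ('a \<Rightarrow> 'b) \<Rightarrow> bool" where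
  "local_homeomorphism X Y f \<longleftrightarrow>
     f \<in> topspace X \<rightarrow> topspace Y \<and>
     (\<forall>x \<in> topspace X. \<exists>U. openin X U \<and> x \<in> U \<and> openin Y (f ` U) \<and>
        homeomorphic_map (subtopology X U) (subtopology Y (f ` U)) f)"

locale etale_groupoid = topological_groupoid +
  assumes local_homeomorphism_rng: "local_homeomorphism (arrow_top \<G>) (unit_top \<G>) (rng \<G>)"
    and local_homeomorphism_src: "local_homeomorphism (arrow_top \<G>) (unit_top \<G>) (src \<G>)"

definition isotropy_at :: "'g groupoid_data \<Rightarrow> 'g \<Rightarrow> 'g set" where
  "isotropy_at \<G> x = {a \<in> arrows \<G>. rng \<G> a = x \<and> src \<G> a = x}"

definition isotropy :: "'g groupoid_data \<Rightarrow> 'g set" where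
  "isotropy \<G> = (\<Union>x \<in> units \<G>. isotropy_at \<G> x)"

definition interior_isotropy :: "'g groupoid_data \<Rightarrow> 'g set" where
  "interior_isotropy \<G> = arrow_top \<G> interior_of isotropy \<G>"

definition minimal_groupoid :: "'g groupoid_data \<Rightarrow> bool" where
  "minimal_groupoid \<G> \<longleftrightarrow>
     (\<forall>u \<in> units \<G>.
        unit_top \<G> closure_of {rng \<G> a | a. a \<in> arrows \<G> \<and> src \<G> a = u} = units \<G>)"

definition continuous_cocycles ::
    "'g groupoid_data \<Rightarrow> 'a topology \<Rightarrow> ('a, 'm) monoid_scheme \<Rightarrow> ('g \<Rightarrow> 'a) set" where
  "continuous_cocycles \<G> T G =
     {c. continuous_map (arrow_top \<G>) T c \<and>
         (\<forall>(a, b) \<in> composable \<G>. c (gmult \<G> a b) = c a \<otimes>\<^bsub>G\<^esub> c b)}"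

definition restrict_groupoid :: "'g groupoid_data \<Rightarrow> 'g set \<Rightarrow> 'g groupoid_data" where
  "restrict_groupoid \<G> A =
     \<G>\<lparr>arrow_top := subtopology (arrow_top \<G>) A, units := units \<G> \<inter> A\<rparr>"

text \<open>
  The groupoid \<open>X \<times> K\<close> for a space \<open>X\<close> and a discrete group \<open>K\<close>. The point \<open>x\<close> of its unit
  space \<open>X\<close> is represented by the arrow \<open>(x, \<one>)\<close>.
\<close>

definition trivial_group_bundle ::
    "'x topology \<Rightarrow> ('a, 'm) monoid_scheme \<Rightarrow> ('x \<times> 'a) groupoid_data" where
  "trivial_group_bundle X K =
     \<lparr>arrow_top = prod_topology X (discrete_topology (carrier K)),
      units = topspace X \<times> {\<one>\<^bsub>K\<^esub>},
      src = (\<lambda>(x, h). (x, \<one>\<^bsub>K\<^esub>)),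
      rng = (\<lambda>(x, h). (x, \<one>\<^bsub>K\<^esub>)),
      gmult = (\<lambda>(x, h) (y, k). (x, h \<otimes>\<^bsub>K\<^esub> k)),
      ginv = (\<lambda>(x, h). (x, inv\<^bsub>K\<^esub> h))\<rparr>"

definition groupoid_hom :: "'g groupoid_data \<Rightarrow> 'h groupoid_data \<Rightarrow> ('g \<Rightarrow> 'h) \<Rightarrow> bool" where
  "groupoid_hom \<G> \<H> f \<longleftrightarrow>
     f \<in> arrows \<G> \<rightarrow> arrows \<H> \<and>
     (\<forall>(a, b) \<in> composable \<G>.
        (f a, f b) \<in> composable \<H> \<and> f (gmult \<G> a b) = gmult \<H> (f a) (f b))"

definition topological_groupoid_iso ::
    "'g groupoid_data \<Rightarrow> 'h groupoid_data \<Rightarrow> ('g \<Rightarrow> 'h) \<Rightarrow> bool" where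
  "topological_groupoid_iso \<G> \<H> f \<longleftrightarrow>
     topological_groupoid \<G> \<and> topological_groupoid \<H> \<and>
     (\<exists>g. homeomorphic_maps (arrow_top \<G>) (arrow_top \<H>) f g \<and>
          groupoid_hom \<G> \<H> f \<and> groupoid_hom \<H> \<G> g)"

end

theory Submission
  imports Defs
begin

text \<open>
  In an etale groupoid the source map is open and products of open sets are open, so the interior
  \<open>I\<close> of the isotropy is a subgroupoid that is invariant under conjugation. For \<open>h\<close> in the group,
  the set of sources of arrows of \<open>I\<close> at which \<open>c\<close> takes the value \<open>h\<close> is therefore open, and it is
  invariant because \<open>c\<close> is constant on conjugacy classes. By minimality this set is empty or the
  whole unit space, so \<open>c(I\<^sub>x)\<close> does not depend on \<open>x\<close>. Hence \<open>s \<times> c\<close> is a continuous open bijection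
  from \<open>I\<close> to \<open>\<G>\<^sup>0 \<times> H\<close>. If \<open>a\<close> is in the closure of \<open>I\<close>, then \<open>a\<close> is isotropy and \<open>c(a) \<in> H\<close>, so some
  \<open>b \<in> I\<close> has the same source and the same value of \<open>c\<close>, and injectivity gives \<open>a = b\<close>.
\<close>

section \<open>Local homeomorphisms: openness and local sections\<close>

lemma local_homeomorphism_imp_open_map:
  assumes "local_homeomorphism X Y f"
  shows "open_map X Y f"
  unfolding open_map_def
proof (intro allI impI)
  fix U assume U: "openin X U"
  show "openin Y (f ` U)"
  proof (subst openin_subopen, intro ballI)
    fix y assume "y \<in> f ` U"
    then obtain x where x: "x \<in> U" "y = f x" by blast
    then have "x \<in> topspace X" using U openin_subset by blast
    then obtain V where V: "openin X V" "x \<in> V" "openin Y (f ` V)"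
      and hom: "homeomorphic_map (subtopology X V) (subtopology Y (f ` V)) f"
      using assms unfolding local_homeomorphism_def by blast
    have "openin (subtopology X V) (V \<inter> U)"
      using U by (simp add: openin_subtopology_Int2)
    then have "openin (subtopology Y (f ` V)) (f ` (V \<inter> U))"
      using hom by (simp add: homeomorphic_eq_everything_map open_map_def)
    then have "openin Y (f ` (V \<inter> U))"
      using V(3) openin_trans_full by blast
    then show "\<exists>T. openin Y T \<and> y \<in> T \<and> T \<subseteq> f ` U"
      using x V(2) by (intro exI[of _ "f ` (V \<inter> U)"]) auto
  qed
qed

text \<open>Provides continuous local inverses with image inside a prescribed open set. For the
  source map, such a section picks an arrow with a given source continuously.\<close>

lemma local_homeomorphism_obtains_section:
  assumes "local_homeomorphism X Y f" and "openin X U" and "x \<in> U"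
  obtains V \<sigma> where "openin X V" "x \<in> V" "V \<subseteq> U" "inj_on f V" "openin Y (f ` V)"
    "continuous_map (subtopology Y (f ` V)) X \<sigma>" "\<And>v. v \<in> V \<Longrightarrow> \<sigma> (f v) = v"
proof -
  have "x \<in> topspace X" using assms(2,3) openin_subset by blast
  then obtain W where W: "openin X W" "x \<in> W" "openin Y (f ` W)"
      and hom: "homeomorphic_map (subtopology X W) (subtopology Y (f ` W)) f"
    using assms(1) unfolding local_homeomorphism_def by blast
  obtain \<sigma> where \<sigma>: "homeomorphic_maps (subtopology X W) (subtopology Y (f ` W)) f \<sigma>"
    using hom homeomorphic_map_maps by blast
  have WX: "topspace X \<inter> W = W" using W(1) openin_subset by blast
  have eq: "\<sigma> (f v) = v" if "v \<in> W" for v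
    using \<sigma> that WX unfolding homeomorphic_maps_def by auto
  have "continuous_map (subtopology Y (f ` W)) X \<sigma>"
    using \<sigma> unfolding homeomorphic_maps_def
    by (simp add: continuous_map_in_subtopology)
  \<comment> \<open>The chart W need not lie in U, so it is shrunk to W \<inter> U; the image stays
    open because f is an open map.\<close>
  then have "continuous_map (subtopology Y (f ` (W \<inter> U))) X \<sigma>"
    by (rule continuous_map_from_subtopology_mono) auto
  moreover have "openin Y (f ` (W \<inter> U))"
    using local_homeomorphism_imp_open_map[OF assms(1)] W(1) assms(2)
    unfolding open_map_def by blast
  moreover have "inj_on f (W \<inter> U)" by (metis eq inj_onI IntD1)
  ultimately show ?thesis
    using W assms eq by (intro that[of "W \<inter> U" \<sigma>]) auto
qed

section \<open>The group bundle as a topological groupoid\<close>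

lemma topological_groupoid_trivial_group_bundle:
  assumes "group K"
  shows "topological_groupoid (trivial_group_bundle X K)"
proof -
  interpret K: group K by fact
  let ?B = "trivial_group_bundle X K"
  let ?T = "prod_topology X (discrete_topology (carrier K))"
  have arr: "arrows ?B = topspace X \<times> carrier K"
    by (simp add: arrows_def trivial_group_bundle_def)
  have comp: "composable ?B =
      {((x, h), (y, k)) | x h y k. x \<in> topspace X \<and> y = x \<and> h \<in> carrier K \<and> k \<in> carrier K}"
    by (auto simp: composable_def arr) (auto simp: trivial_group_bundle_def)
  have gpd: "groupoid ?B"
    by unfold_locales
      (auto simp: arr comp, auto simp: trivial_group_bundle_def K.m_assoc)
  have unit: "continuous_map ?T (subtopology ?T (topspace X \<times> {\<one>\<^bsub>K\<^esub>})) (\<lambda>(x, h). (x, \<one>\<^bsub>K\<^esub>))"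
    unfolding case_prod_unfold
    by (intro continuous_map_into_subtopology continuous_map_pairedI continuous_map_fst) auto
  have inv: "continuous_map ?T ?T (\<lambda>(x, h). (x, inv\<^bsub>K\<^esub> h))"
  proof -
    have "continuous_map (discrete_topology (carrier K)) (discrete_topology (carrier K))
        (\<lambda>h. inv\<^bsub>K\<^esub> h)" by simp
    from continuous_map_compose[OF continuous_map_snd this]
    show ?thesis unfolding case_prod_unfold
      by (intro continuous_map_pairedI continuous_map_fst) (simp add: o_def)
  qed
  \<comment> \<open>The formula that keeps the left base point makes sense for all pairs, so
    continuity is shown on the full product and restricted to composable pairs at the end.\<close>
  have mult: "continuous_map (prod_topology ?T ?T) ?T (\<lambda>(a, b). (fst a, snd a \<otimes>\<^bsub>K\<^esub> snd b))"
  proof -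
    let ?D = "discrete_topology (carrier K)"
    \<comment> \<open>A product of two discrete spaces is discrete, so only closure of the carrier
      under multiplication matters.\<close>
    have "continuous_map (prod_topology ?D ?D) ?D (\<lambda>p. fst p \<otimes>\<^bsub>K\<^esub> snd p)"
      unfolding prod_topology_discrete_topology[symmetric] by auto
    moreover have "continuous_map (prod_topology ?T ?T) (prod_topology ?D ?D)
        (\<lambda>p. (snd (fst p), snd (snd p)))"
      by (intro continuous_map_pairedI
          continuous_map_compose[OF continuous_map_fst continuous_map_snd, unfolded o_def]
          continuous_map_compose[OF continuous_map_snd continuous_map_snd, unfolded o_def])
    ultimately have "continuous_map (prod_topology ?T ?T) ?D (\<lambda>p. snd (fst p) \<otimes>\<^bsub>K\<^esub> snd (snd p))"
      by (drule_tac continuous_map_compose) (auto simp: o_def)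
    then show ?thesis unfolding case_prod_unfold
      by (intro continuous_map_pairedI
          continuous_map_compose[OF continuous_map_fst continuous_map_fst, unfolded o_def])
  qed
  have mult': "gmult ?B = (\<lambda>a b. (fst a, snd a \<otimes>\<^bsub>K\<^esub> snd b))"
    by (auto simp: trivial_group_bundle_def fun_eq_iff)
  show ?thesis
  proof (intro topological_groupoid.intro gpd topological_groupoid_axioms.intro)
    show "continuous_map (subtopology (prod_topology (arrow_top ?B) (arrow_top ?B)) (composable ?B))
         (arrow_top ?B) (\<lambda>(a, b). gmult ?B a b)"
      unfolding mult'
      by (rule continuous_map_from_subtopology) (use mult in \<open>simp add: trivial_group_bundle_def\<close>)
  qed (use unit inv in \<open>simp_all add: unit_top_def trivial_group_bundle_def\<close>)
qed

section \<open>Groupoid algebra and setwise products\<close>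

context groupoid
begin

lemma composable_iff: "(a, b) \<in> composable \<G> \<longleftrightarrow> a \<in> arrows \<G> \<and> b \<in> arrows \<G> \<and> src \<G> a = rng \<G> b"
  by (simp add: composable_def)

lemma isotropy_iff: "a \<in> isotropy \<G> \<longleftrightarrow> a \<in> arrows \<G> \<and> rng \<G> a = src \<G> a"
  by (auto simp: isotropy_def isotropy_at_def src_closed)

text \<open>The name \<open>inv_closed\<close> is shadowed by that of monoids once a group is added to the context.\<close>

lemmas ginv_closed = inv_closed

lemma mult_inv_cancel_right:
  assumes "(a, b) \<in> composable \<G>"
  shows "gmult \<G> (gmult \<G> a b) (ginv \<G> b) = a"
  using assms mult_assoc[of a b "ginv \<G> b"] src_mult_right[of a]
  by (simp add: composable_iff inv_closed rng_inv inv_mult_right)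

lemma inv_mult_cancel_right:
  assumes "a \<in> arrows \<G>" "b \<in> arrows \<G>" "src \<G> a = src \<G> b"
  shows "gmult \<G> (gmult \<G> a (ginv \<G> b)) b = a"
  using assms mult_assoc[of a "ginv \<G> b" b] src_mult_right[of a]
  by (simp add: composable_iff inv_closed rng_inv src_inv inv_mult_left)

text \<open>The product of the double inverse, the inverse and a itself, bracketed in two ways,
  gives the double inverse on one side and r(a)a = a on the other.\<close>

lemma ginv_ginv:
  assumes "a \<in> arrows \<G>"
  shows "ginv \<G> (ginv \<G> a) = a"
  using assms inv_mult_cancel_right[of "ginv \<G> (ginv \<G> a)" a]
    rng_mult_left[of a]
  by (simp add: inv_closed src_inv rng_inv inv_mult_left)

text \<open>The setwise product AB. Composability is imposed because \<open>gmult\<close> is a total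
  function whose values on other pairs carry no meaning.\<close>

definition arrow_set_mult :: "'g set \<Rightarrow> 'g set \<Rightarrow> 'g set" where
  "arrow_set_mult A B = {gmult \<G> a b | a b. a \<in> A \<and> b \<in> B \<and> (a, b) \<in> composable \<G>}"

end

section \<open>Subgroupoids with the subspace topology\<close>

lemma (in topological_groupoid) topological_groupoid_restrict:
  assumes sub: "A \<subseteq> arrows \<G>"
    and inv: "\<And>a. a \<in> A \<Longrightarrow> ginv \<G> a \<in> A"
    and mult: "\<And>a b. a \<in> A \<Longrightarrow> b \<in> A \<Longrightarrow> (a, b) \<in> composable \<G> \<Longrightarrow> gmult \<G> a b \<in> A"
  shows "topological_groupoid (restrict_groupoid \<G> A)"
proof -
  let ?R = "restrict_groupoid \<G> A"
  have sel [simp]: "src ?R = src \<G>" "rng ?R = rng \<G>" "gmult ?R = gmult \<G>" "ginv ?R = ginv \<G>"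
    "units ?R = units \<G> \<inter> A" "arrow_top ?R = subtopology (arrow_top \<G>) A"
    by (simp_all add: restrict_groupoid_def)
  have arr [simp]: "arrows ?R = A" using sub by (auto simp: arrows_def)
  have comp: "composable ?R = composable \<G> \<inter> A \<times> A"
    using sub by (auto simp: composable_def)
  \<comment> \<open>The source of a is the product a\<inverse>a of two elements of A, so closure
    under inverses and products already brings in the required units. Ranges follow by passing to
    inverses.\<close>
  have srcA: "src \<G> a \<in> units \<G> \<inter> A" if "a \<in> A" for a
    using mult[OF inv[OF that] that] that sub src_closed[of a]
    by (auto simp: composable_iff inv_closed src_inv inv_mult_left)
  have rngA: "rng \<G> a \<in> units \<G> \<inter> A" if "a \<in> A" for a
    using srcA[OF inv[OF that]] that sub by (auto simp: src_inv)
  have gpd: "groupoid ?R"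
    using sub srcA rngA mult inv
    by unfold_locales
      (auto simp: comp src_unit rng_unit src_mult rng_mult mult_assoc rng_mult_left
        src_mult_right src_inv rng_inv inv_mult_left inv_mult_right subset_iff)
  have ut: "unit_top ?R = subtopology (arrow_top \<G>) (units \<G> \<inter> A)"
    by (simp add: unit_top_def subtopology_subtopology Int_absorb1 inf.commute inf.left_commute)
  have sr: "continuous_map (arrow_top ?R) (unit_top ?R) f"
    if "continuous_map (arrow_top \<G>) (unit_top \<G>) f" "\<And>a. a \<in> A \<Longrightarrow> f a \<in> units \<G> \<inter> A" for f
    using that unfolding ut unit_top_def sel continuous_map_in_subtopology
    by (auto intro: continuous_map_from_subtopology)
  show ?thesis
  proof (intro topological_groupoid.intro gpd topological_groupoid_axioms.intro)
    show "continuous_map (arrow_top ?R) (unit_top ?R) (src ?R)"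
      unfolding sel(1) by (rule sr[OF continuous_src srcA])
    show "continuous_map (arrow_top ?R) (unit_top ?R) (rng ?R)"
      unfolding sel(2) by (rule sr[OF continuous_rng rngA])
    show "continuous_map (arrow_top ?R) (arrow_top ?R) (ginv ?R)"
      using inv unfolding sel
      by (intro continuous_map_into_subtopology continuous_map_from_subtopology continuous_inv) auto
    have "continuous_map (subtopology (prod_topology (arrow_top \<G>) (arrow_top \<G>))
        (composable \<G> \<inter> A \<times> A)) (arrow_top \<G>) (\<lambda>(a, b). gmult \<G> a b)"
      by (rule continuous_map_from_subtopology_mono[OF continuous_mult]) auto
    \<comment> \<open>Taking subspaces commutes with products, so the composable pairs in A carry
      the topology restricted from those of the whole groupoid.\<close>
    moreover have "subtopology (prod_topology (arrow_top ?R) (arrow_top ?R)) (composable ?R)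
       = subtopology (prod_topology (arrow_top \<G>) (arrow_top \<G>)) (composable \<G> \<inter> A \<times> A)"
      unfolding sel comp subtopology_Times[symmetric] subtopology_subtopology
      by (simp add: inf.commute inf.left_commute)
    ultimately show "continuous_map
        (subtopology (prod_topology (arrow_top ?R) (arrow_top ?R)) (composable ?R))
        (arrow_top ?R) (\<lambda>(a, b). gmult ?R a b)"
      using mult by (auto intro!: continuous_map_into_subtopology)
  qed
qed

section \<open>Open sets of arrows in an etale groupoid\<close>

context etale_groupoid
begin

text \<open>Let the range map be injective on a neighbourhood V of u. If a and r(a) both lie in V,
  they have the same range, so a = r(a) is a unit; by continuity such a form a neighbourhood of
  u.\<close>

lemma openin_units: "openin (arrow_top \<G>) (units \<G>)"
proof (subst openin_subopen, intro ballI)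
  fix u assume u: "u \<in> units \<G>"
  then have "u \<in> topspace (arrow_top \<G>)" using units_subset by (auto simp: arrows_def)
  then obtain V where V: "openin (arrow_top \<G>) V" "u \<in> V" "inj_on (rng \<G>) V"
    using local_homeomorphism_obtains_section[OF local_homeomorphism_rng openin_topspace] by metis
  let ?W = "V \<inter> {a \<in> topspace (arrow_top \<G>). rng \<G> a \<in> V}"
  have "continuous_map (arrow_top \<G>) (arrow_top \<G>) (rng \<G>)"
    using continuous_rng by (simp add: unit_top_def continuous_map_in_subtopology)
  then have "openin (arrow_top \<G>) ?W"
    using V(1) openin_continuous_map_preimage by blast
  moreover have "u \<in> ?W" using u V units_subset by (auto simp: arrows_def rng_unit)
  moreover have "?W \<subseteq> units \<G>"
  proof
    fix a assume a: "a \<in> ?W"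
    then have "rng \<G> a \<in> units \<G>" by (simp add: rng_closed arrows_def)
    moreover have "rng \<G> a = a"
      using a V(3) calculation by (auto simp: rng_unit inj_on_def)
    ultimately show "a \<in> units \<G>" by simp
  qed
  ultimately show "\<exists>T. openin (arrow_top \<G>) T \<and> u \<in> T \<and> T \<subseteq> units \<G>" by blast
qed

text \<open>Inversion is an involution, so the image is a preimage under a continuous map.\<close>

lemma openin_inv_image:
  assumes "openin (arrow_top \<G>) A"
  shows "openin (arrow_top \<G>) (ginv \<G> ` A)"
proof -
  have sub: "A \<subseteq> arrows \<G>" using assms openin_subset by (auto simp: arrows_def)
  have "ginv \<G> ` A = {b \<in> topspace (arrow_top \<G>). ginv \<G> b \<in> A}" (is "_ = ?P")
  proof
    show "ginv \<G> ` A \<subseteq> ?P"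
      using sub ginv_ginv inv_closed by (auto simp flip: arrows_def simp: subset_iff)
    show "?P \<subseteq> ginv \<G> ` A"
      using ginv_ginv by (auto simp flip: arrows_def intro!: image_eqI)
  qed
  then show ?thesis using openin_continuous_map_preimage[OF continuous_inv assms] by simp
qed

text \<open>Near p = ab, every arrow e can be divided on the right by the arrow close to b with the
  same source as e. The quotient depends continuously on e and equals a at e = p, so it remains in A
  near p, which puts e in AB.\<close>

lemma openin_arrow_set_mult:
  assumes A: "openin (arrow_top \<G>) A" and B: "openin (arrow_top \<G>) B"
  shows "openin (arrow_top \<G>) (arrow_set_mult A B)"
proof (subst openin_subopen, intro ballI)
  let ?T = "arrow_top \<G>"
  fix p assume "p \<in> arrow_set_mult A B"
  then obtain a b where ab: "a \<in> A" "b \<in> B" "(a, b) \<in> composable \<G>" and p: "p = gmult \<G> a b"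
    by (auto simp: arrow_set_mult_def)
  obtain D \<sigma> where D: "openin ?T D" "b \<in> D" "D \<subseteq> B" "openin (unit_top \<G>) (src \<G> ` D)"
    and \<sigma>: "continuous_map (subtopology (unit_top \<G>) (src \<G> ` D)) ?T \<sigma>"
    and \<sigma>_src: "\<And>v. v \<in> D \<Longrightarrow> \<sigma> (src \<G> v) = v"
    using local_homeomorphism_obtains_section[OF local_homeomorphism_src B ab(2)] by metis
  have D_sub: "D \<subseteq> arrows \<G>" using D(1) openin_subset by (auto simp: arrows_def)
  \<comment> \<open>E is where the local section \<sigma> of the source map can be applied to s(e);
    f is then the quotient of e by \<sigma>(s(e)).\<close>
  define E where "E = {e \<in> topspace ?T. src \<G> e \<in> src \<G> ` D}"
  define f where "f = (\<lambda>e. gmult \<G> e (ginv \<G> (\<sigma> (src \<G> e))))"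
  have E: "openin ?T E"
    unfolding E_def using openin_continuous_map_preimage[OF continuous_src D(4)] .
  have TE: "topspace (subtopology ?T E) = E" by (auto simp: E_def)
  have \<sigma>E: "\<sigma> (src \<G> e) \<in> D \<and> src \<G> (\<sigma> (src \<G> e)) = src \<G> e" if "e \<in> E" for e
    using that \<sigma>_src by (auto simp: E_def)
  have EG: "e \<in> arrows \<G>" if "e \<in> E" for e using that by (simp add: E_def arrows_def)
  have "continuous_map (subtopology ?T E) (subtopology (unit_top \<G>) (src \<G> ` D)) (src \<G>)"
    by (intro continuous_map_into_subtopology continuous_map_from_subtopology continuous_src)
      (auto simp: E_def)
  from continuous_map_compose[OF continuous_map_compose[OF this \<sigma>] continuous_inv]
  have "continuous_map (subtopology ?T E) ?T (\<lambda>e. ginv \<G> (\<sigma> (src \<G> e)))"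
    by (simp add: o_def)
  moreover have "continuous_map (subtopology ?T E) ?T (\<lambda>e. e)"
    by (intro continuous_map_from_subtopology) simp
  moreover have "(e, ginv \<G> (\<sigma> (src \<G> e))) \<in> composable \<G>" if "e \<in> E" for e
    using \<sigma>E[OF that] EG[OF that] D_sub by (auto simp: composable_iff inv_closed rng_inv)
  ultimately have "continuous_map (subtopology ?T E)
      (subtopology (prod_topology ?T ?T) (composable \<G>)) (\<lambda>e. (e, ginv \<G> (\<sigma> (src \<G> e))))"
    unfolding continuous_map_in_subtopology TE
    by (intro conjI continuous_map_pairedI) auto
  from continuous_map_compose[OF this continuous_mult]
  have f: "continuous_map (subtopology ?T E) ?T f" by (simp add: o_def f_def)
  have "openin (subtopology ?T E) {e \<in> E. f e \<in> A}"
    using openin_continuous_map_preimage[OF f A] unfolding TE .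
  then have "openin ?T {e \<in> E. f e \<in> A}" using E openin_trans_full by blast
  \<comment> \<open>Since s(p) = s(b), the section returns b, and f(p) = (ab)b\<inverse> =
    a.\<close>
  moreover have "p \<in> {e \<in> E. f e \<in> A}"
    using ab D(2) \<sigma>_src[OF D(2)] mult_closed[OF ab(3)]
    by (auto simp: E_def f_def p src_mult mult_inv_cancel_right simp flip: arrows_def)
  moreover have "{e \<in> E. f e \<in> A} \<subseteq> arrow_set_mult A B"
  proof clarify
    fix e assume e: "e \<in> E" "f e \<in> A"
    let ?d = "\<sigma> (src \<G> e)"
    have d: "?d \<in> D" "?d \<in> arrows \<G>" "src \<G> ?d = src \<G> e" "e \<in> arrows \<G>"
      using \<sigma>E[OF e(1)] D_sub EG[OF e(1)] by auto
    then have ed: "(e, ginv \<G> ?d) \<in> composable \<G>"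
      by (simp add: composable_iff inv_closed rng_inv)
    \<comment> \<open>Multiplying the quotient back by \<sigma>(s(e)), an element of D \<subseteq>
      B, exhibits e as a member of AB.\<close>
    have "e = gmult \<G> (f e) ?d" using d inv_mult_cancel_right[of e ?d] by (simp add: f_def)
    moreover have "(f e, ?d) \<in> composable \<G>"
      using d ed by (simp add: composable_iff f_def mult_closed src_mult src_inv)
    ultimately show "e \<in> arrow_set_mult A B"
      using e(2) d(1) D(3) unfolding arrow_set_mult_def by blast
  qed
  ultimately show "\<exists>T. openin ?T T \<and> p \<in> T \<and> T \<subseteq> arrow_set_mult A B" by blast
qed

section \<open>The interior of the isotropy as a conjugation-invariant subgroupoid\<close>

lemma openin_interior_isotropy: "openin (arrow_top \<G>) (interior_isotropy \<G>)"
  by (simp add: interior_isotropy_def)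

lemma interior_isotropyI:
  "openin (arrow_top \<G>) U \<Longrightarrow> U \<subseteq> isotropy \<G> \<Longrightarrow> a \<in> U \<Longrightarrow> a \<in> interior_isotropy \<G>"
  unfolding interior_isotropy_def by (meson interior_of_maximal subsetD)

lemma interior_isotropyD:
  assumes "a \<in> interior_isotropy \<G>"
  shows "a \<in> arrows \<G>" "rng \<G> a = src \<G> a"
proof -
  have "a \<in> isotropy \<G>"
    using subsetD[OF interior_of_subset] assms unfolding interior_isotropy_def .
  then show "a \<in> arrows \<G>" "rng \<G> a = src \<G> a" by (simp_all add: isotropy_iff)
qed

lemma units_subset_interior_isotropy: "units \<G> \<subseteq> interior_isotropy \<G>"
proof -
  have "units \<G> \<subseteq> isotropy \<G>"
    using units_subset by (auto simp: isotropy_iff src_unit rng_unit)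
  from interior_isotropyI[OF openin_units this] show ?thesis by (rule subsetI)
qed

text \<open>The inverses of interior isotropy form an open set of isotropy, which the interior must
  contain. The closure under products uses the setwise product in the same way.\<close>

lemma interior_isotropy_inv:
  assumes "a \<in> interior_isotropy \<G>"
  shows "ginv \<G> a \<in> interior_isotropy \<G>"
proof (rule interior_isotropyI[OF openin_inv_image[OF openin_interior_isotropy]])
  show "ginv \<G> ` interior_isotropy \<G> \<subseteq> isotropy \<G>"
    using interior_isotropyD by (auto simp: isotropy_iff inv_closed src_inv rng_inv)
qed (rule imageI[OF assms])

lemma interior_isotropy_mult:
  assumes "a \<in> interior_isotropy \<G>" "b \<in> interior_isotropy \<G>" "(a, b) \<in> composable \<G>"
  shows "gmult \<G> a b \<in> interior_isotropy \<G>"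
proof (rule interior_isotropyI[OF openin_arrow_set_mult[OF openin_interior_isotropy
        openin_interior_isotropy]])
  show "arrow_set_mult (interior_isotropy \<G>) (interior_isotropy \<G>) \<subseteq> isotropy \<G>"
  proof
    fix p assume "p \<in> arrow_set_mult (interior_isotropy \<G>) (interior_isotropy \<G>)"
    then obtain d e where p: "p = gmult \<G> d e" and de: "(d, e) \<in> composable \<G>"
      and "d \<in> interior_isotropy \<G>" "e \<in> interior_isotropy \<G>"
      by (auto simp: arrow_set_mult_def)
    then have "rng \<G> d = src \<G> e"
      using interior_isotropyD(2) by (metis composable_iff)
    then show "p \<in> isotropy \<G>"
      by (simp add: p isotropy_iff mult_closed[OF de] src_mult[OF de] rng_mult[OF de])
  qed
  show "gmult \<G> a b \<in> arrow_set_mult (interior_isotropy \<G>) (interior_isotropy \<G>)"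
    unfolding arrow_set_mult_def using assms by blast
qed

text \<open>For an open set \<open>D\<close> on which the source map is injective, \<open>D I D\<inverse>\<close> consists of isotropy:
  in a product \<open>d b e\<inverse>\<close> the factors \<open>d\<close> and \<open>e\<close> have the same source.\<close>

lemma interior_isotropy_conjugate:
  assumes a: "a \<in> interior_isotropy \<G>" and g: "g \<in> arrows \<G>" "src \<G> g = src \<G> a"
  shows "gmult \<G> (gmult \<G> g a) (ginv \<G> g) \<in> interior_isotropy \<G>"
proof -
  let ?I = "interior_isotropy \<G>"
  have "g \<in> topspace (arrow_top \<G>)" using g by (simp add: arrows_def)
  then obtain D where D: "openin (arrow_top \<G>) D" "g \<in> D" and inj: "inj_on (src \<G>) D"
    using local_homeomorphism_obtains_section[OF local_homeomorphism_src openin_topspace] by metis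
  have D_sub: "D \<subseteq> arrows \<G>" using D(1) openin_subset by (auto simp: arrows_def)
  let ?C = "arrow_set_mult (arrow_set_mult D ?I) (ginv \<G> ` D)"
  show ?thesis
  proof (rule interior_isotropyI[of ?C])
    show "openin (arrow_top \<G>) ?C"
      by (intro openin_arrow_set_mult openin_inv_image openin_interior_isotropy D(1))
    show "?C \<subseteq> isotropy \<G>"
    proof
      fix p assume "p \<in> ?C"
      then obtain d b e where p: "p = gmult \<G> (gmult \<G> d b) (ginv \<G> e)" "d \<in> D" "b \<in> ?I" "e \<in> D"
        and db: "(d, b) \<in> composable \<G>" and dbe: "(gmult \<G> d b, ginv \<G> e) \<in> composable \<G>"
        by (auto simp: arrow_set_mult_def)
      have e: "e \<in> arrows \<G>" using p(4) D_sub by blast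
      have "src \<G> d = src \<G> b" using db interior_isotropyD(2)[OF p(3)] by (simp add: composable_iff)
      also have "\<dots> = src \<G> e"
        using dbe e by (simp add: composable_iff src_mult[OF db] rng_inv)
      finally have "d = e" using inj p(2,4) by (simp add: inj_on_def)
      then show "p \<in> isotropy \<G>"
        using mult_closed[OF dbe] src_mult[OF dbe] rng_mult[OF dbe] rng_mult[OF db] e
        by (simp add: p(1) isotropy_iff src_inv)
    qed
    have ga: "(g, a) \<in> composable \<G>" using a g interior_isotropyD by (simp add: composable_iff)
    moreover have "(gmult \<G> g a, ginv \<G> g) \<in> composable \<G>"
      using g ga by (simp add: composable_iff mult_closed[OF ga] src_mult[OF ga] inv_closed rng_inv)
    ultimately show "gmult \<G> (gmult \<G> g a) (ginv \<G> g) \<in> ?C"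
      using a D(2) unfolding arrow_set_mult_def by blast
  qed
qed

lemma topological_groupoid_interior_isotropy:
  "topological_groupoid (restrict_groupoid \<G> (interior_isotropy \<G>))"
  using interior_isotropyD(1) interior_isotropy_inv interior_isotropy_mult
  by (intro topological_groupoid_restrict) auto

end

section \<open>Cocycles with values in a discrete abelian group\<close>

locale cocycle_etale_groupoid = etale_groupoid \<G> + comm_group G
  for \<G> :: "'g groupoid_data" and G :: "('a, 'm) monoid_scheme" +
  fixes c :: "'g \<Rightarrow> 'a"
  assumes cocycle: "c \<in> continuous_cocycles \<G> (discrete_topology (carrier G)) G"
begin

lemma continuous_cocycle: "continuous_map (arrow_top \<G>) (discrete_topology (carrier G)) c"
  using cocycle by (simp add: continuous_cocycles_def)

lemma cocycle_closed: "a \<in> arrows \<G> \<Longrightarrow> c a \<in> carrier G"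
  using continuous_map_image_subset_topspace[OF continuous_cocycle] by (auto simp: arrows_def)

lemma cocycle_mult: "(a, b) \<in> composable \<G> \<Longrightarrow> c (gmult \<G> a b) = c a \<otimes>\<^bsub>G\<^esub> c b"
  using cocycle by (auto simp: continuous_cocycles_def)

text \<open>A unit is idempotent, and a group has no idempotent but its identity.\<close>

lemma cocycle_unit:
  assumes "u \<in> units \<G>"
  shows "c u = \<one>\<^bsub>G\<^esub>"
proof -
  have u: "u \<in> arrows \<G>" using assms units_subset by blast
  then have "(u, u) \<in> composable \<G>" using assms by (simp add: composable_iff src_unit rng_unit)
  moreover have "gmult \<G> u u = u" using rng_mult_left[OF u] by (simp add: assms rng_unit)
  ultimately have "c u \<otimes>\<^bsub>G\<^esub> c u = c u" using cocycle_mult by metis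
  then show ?thesis using cocycle_closed[OF u] by simp
qed

lemma cocycle_inv:
  assumes "a \<in> arrows \<G>"
  shows "c (ginv \<G> a) = inv\<^bsub>G\<^esub> (c a)"
proof -
  have "(ginv \<G> a, a) \<in> composable \<G>" using assms by (simp add: composable_iff ginv_closed src_inv)
  then have "c (ginv \<G> a) \<otimes>\<^bsub>G\<^esub> c a = \<one>\<^bsub>G\<^esub>"
    using cocycle_mult[of "ginv \<G> a" a] cocycle_unit[OF src_closed[OF assms]] assms
    by (simp add: inv_mult_left)
  then show ?thesis using assms by (simp add: cocycle_closed ginv_closed inv_equality)
qed

text \<open>Commutativity of G cancels c(g) against its inverse. Hence values of c survive transport
  of isotropy along arrows.\<close>

lemma cocycle_conjugate:
  assumes "a \<in> arrows \<G>" "rng \<G> a = src \<G> a" "g \<in> arrows \<G>" "src \<G> g = src \<G> a"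
  shows "c (gmult \<G> (gmult \<G> g a) (ginv \<G> g)) = c a"
proof -
  have ga: "(g, a) \<in> composable \<G>" using assms by (simp add: composable_iff)
  moreover have "(gmult \<G> g a, ginv \<G> g) \<in> composable \<G>"
    using assms ga by (simp add: composable_iff mult_closed[OF ga] src_mult[OF ga] ginv_closed rng_inv)
  ultimately have "c (gmult \<G> (gmult \<G> g a) (ginv \<G> g)) = (c g \<otimes>\<^bsub>G\<^esub> c a) \<otimes>\<^bsub>G\<^esub> inv\<^bsub>G\<^esub> (c g)"
    using assms by (simp add: cocycle_mult cocycle_inv)
  then show ?thesis
    using assms(1,3) by (simp add: cocycle_closed m_comm[of "c g"] m_assoc)
qed

section \<open>Independence of the cocycle image from the unit\<close>

definition interior_level :: "'a \<Rightarrow> 'g set" where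
  "interior_level h = {a \<in> interior_isotropy \<G>. c a = h}"

lemma openin_interior_level: "openin (arrow_top \<G>) (interior_level h)"
proof (cases "h \<in> carrier G")
  case True
  have "openin (arrow_top \<G>) {a \<in> topspace (arrow_top \<G>). c a \<in> {h}}"
    using True by (intro openin_continuous_map_preimage[OF continuous_cocycle]) auto
  then have "openin (arrow_top \<G>) (interior_isotropy \<G> \<inter> {a \<in> topspace (arrow_top \<G>). c a \<in> {h}})"
    using openin_interior_isotropy by blast
  moreover have "interior_isotropy \<G> \<inter> {a \<in> topspace (arrow_top \<G>). c a \<in> {h}} = interior_level h"
    using interior_isotropyD(1) by (auto simp: interior_level_def simp flip: arrows_def)
  ultimately show ?thesis by simp
next
  \<comment> \<open>The singleton of h is not open in the discrete space on the carrier here, but no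
    arrow takes the value h.\<close>
  case False
  then have "interior_level h = {}"
    using interior_isotropyD(1) cocycle_closed by (auto simp: interior_level_def)
  then show ?thesis by simp
qed

text \<open>Turns a question about subsets of G into one about subsets of the unit space, where
  openness and density can be used.\<close>

lemma cocycle_interior_fibre_iff:
  "h \<in> c ` (interior_isotropy \<G> \<inter> isotropy_at \<G> x) \<longleftrightarrow> x \<in> src \<G> ` interior_level h"
  using interior_isotropyD by (auto simp: isotropy_at_def interior_level_def image_iff)

text \<open>The units over which h is attained form an open set containing x. The orbit of y is
  dense, so it meets this set at some r(g) with s(g) = y, and conjugation brings the value h from
  r(g) to y.\<close>

lemma cocycle_interior_fibre_subset:
  assumes min: "minimal_groupoid \<G>" and x: "x \<in> units \<G>" and y: "y \<in> units \<G>"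
  shows "c ` (interior_isotropy \<G> \<inter> isotropy_at \<G> x) \<subseteq> c ` (interior_isotropy \<G> \<inter> isotropy_at \<G> y)"
proof
  fix h assume h: "h \<in> c ` (interior_isotropy \<G> \<inter> isotropy_at \<G> x)"
  let ?S = "src \<G> ` interior_level h"
  have "openin (unit_top \<G>) ?S"
    using local_homeomorphism_imp_open_map[OF local_homeomorphism_src] openin_interior_level
    by (simp add: open_map_def)
  moreover have "x \<in> ?S" using h by (simp only: cocycle_interior_fibre_iff)
  moreover have "x \<in> unit_top \<G> closure_of {rng \<G> g | g. g \<in> arrows \<G> \<and> src \<G> g = y}"
    using min x y unfolding minimal_groupoid_def by blast
  ultimately obtain g where g: "g \<in> arrows \<G>" "src \<G> g = y" "rng \<G> g \<in> ?S"
    unfolding in_closure_of by blast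
  then obtain a where a: "a \<in> interior_isotropy \<G>" "c a = h" "src \<G> a = rng \<G> g"
    by (auto simp: interior_level_def)
  \<comment> \<open>The inverse of g has source r(g) = s(a) and range y, so conjugating a by it
    gives isotropy at y.\<close>
  let ?g' = "ginv \<G> g"
  let ?b = "gmult \<G> (gmult \<G> ?g' a) (ginv \<G> ?g')"
  have g': "?g' \<in> arrows \<G>" "src \<G> ?g' = src \<G> a" using g a by (simp_all add: ginv_closed src_inv)
  have b: "?b \<in> interior_isotropy \<G>" "c ?b = h"
    using interior_isotropy_conjugate[OF a(1) g'] cocycle_conjugate[OF interior_isotropyD[OF a(1)] g'] a(2)
    by simp_all
  have ga: "(?g', a) \<in> composable \<G>" using g' interior_isotropyD[OF a(1)] by (simp add: composable_iff)
  have "(gmult \<G> ?g' a, ginv \<G> ?g') \<in> composable \<G>"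
    using g' ga by (simp add: composable_iff mult_closed[OF ga] src_mult[OF ga] ginv_closed rng_inv)
  then have "src \<G> ?b = y" using g g' by (simp add: src_mult ginv_ginv)
  then show "h \<in> c ` (interior_isotropy \<G> \<inter> isotropy_at \<G> y)"
    using b by (subst cocycle_interior_fibre_iff) (auto simp: interior_level_def)
qed

text \<open>The interior isotropy at x is a group with identity x, and c is multiplicative on
  it.\<close>

lemma subgroup_cocycle_interior_fibre:
  assumes x: "x \<in> units \<G>"
  shows "subgroup (c ` (interior_isotropy \<G> \<inter> isotropy_at \<G> x)) G" (is "subgroup (c ` ?I) G")
proof (rule subgroupI)
  show "c ` ?I \<subseteq> carrier G" using cocycle_closed by (auto simp: isotropy_at_def)
  have "x \<in> ?I"
    using x units_subset units_subset_interior_isotropy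
    by (auto simp: isotropy_at_def src_unit rng_unit)
  then show "c ` ?I \<noteq> {}" by blast
next
  fix h assume "h \<in> c ` ?I"
  then obtain a where a: "a \<in> ?I" "h = c a" by blast
  then have "ginv \<G> a \<in> ?I" "c (ginv \<G> a) = inv\<^bsub>G\<^esub> h"
    by (auto simp: isotropy_at_def ginv_closed src_inv rng_inv interior_isotropy_inv cocycle_inv)
  then show "inv\<^bsub>G\<^esub> h \<in> c ` ?I" by (metis imageI)
next
  fix h k assume "h \<in> c ` ?I" "k \<in> c ` ?I"
  then obtain a b where ab: "a \<in> ?I" "h = c a" "b \<in> ?I" "k = c b" by blast
  then have "(a, b) \<in> composable \<G>" by (simp add: composable_iff isotropy_at_def)
  then have "gmult \<G> a b \<in> ?I" "c (gmult \<G> a b) = h \<otimes>\<^bsub>G\<^esub> k"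
    using ab by (auto simp: isotropy_at_def mult_closed src_mult rng_mult interior_isotropy_mult
        cocycle_mult)
  then show "h \<otimes>\<^bsub>G\<^esub> k \<in> c ` ?I" by (metis imageI)
qed

section \<open>The map s \<times> c on the interior of the isotropy\<close>

text \<open>Injectivity of c on isotropy groups makes the map injective, and the common image H
  makes it surjective. It is open because the source map is open and c is locally constant.\<close>

lemma homeomorphic_map_src_cocycle:
  assumes inj: "\<And>x. x \<in> units \<G> \<Longrightarrow> inj_on c (isotropy_at \<G> x)"
    and H: "\<And>x. x \<in> units \<G> \<Longrightarrow> c ` (interior_isotropy \<G> \<inter> isotropy_at \<G> x) = H"
  shows "homeomorphic_map (subtopology (arrow_top \<G>) (interior_isotropy \<G>))
           (prod_topology (unit_top \<G>) (discrete_topology H)) (\<lambda>a. (src \<G> a, c a))"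
    (is "homeomorphic_map ?TI ?P ?f")
proof (rule bijective_open_imp_homeomorphic_map)
  let ?I = "interior_isotropy \<G>"
  have I_sub: "?I \<subseteq> arrows \<G>" using interior_isotropyD(1) by blast
  have TI: "topspace ?TI = ?I" using I_sub by (auto simp: arrows_def)
  have UT: "topspace (unit_top \<G>) = units \<G>"
    using units_subset by (auto simp: unit_top_def arrows_def)
  have cH: "c a \<in> H" if "a \<in> ?I" for a
    using that H[of "src \<G> a"] interior_isotropyD[OF that]
    by (auto simp: isotropy_at_def src_closed)
  have "continuous_map ?TI (subtopology (discrete_topology (carrier G)) H) c"
    using cH TI
    by (intro continuous_map_into_subtopology continuous_map_from_subtopology[OF continuous_cocycle]) auto
  \<comment> \<open>Without units the assumption on H is vacuous and H is arbitrary; in that case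
    there are no arrows and continuity is trivial.\<close>
  moreover have "H \<subseteq> carrier G" if "units \<G> \<noteq> {}"
    using that H cocycle_closed by (auto simp: isotropy_at_def)
  moreover have "?TI = trivial_topology" if "units \<G> = {}"
    using that TI I_sub src_closed by (metis all_not_in_conv null_topspace_iff_trivial subset_iff)
  ultimately have "continuous_map ?TI (discrete_topology H) c"
    by (cases "units \<G> = {}") (simp_all add: Int_absorb1)
  then show "continuous_map ?TI ?P ?f"
    by (intro continuous_map_pairedI continuous_map_from_subtopology[OF continuous_src])
  show "?f ` topspace ?TI = topspace ?P"
  proof
    show "?f ` topspace ?TI \<subseteq> topspace ?P"
      using cH I_sub src_closed unfolding TI by (auto simp: UT)
    show "topspace ?P \<subseteq> ?f ` topspace ?TI"
    proof clarsimp
      fix x h assume "x \<in> topspace (unit_top \<G>)" "h \<in> H"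
      then have "h \<in> c ` (?I \<inter> isotropy_at \<G> x)" using H UT by blast
      then obtain a where "a \<in> ?I" "a \<in> arrows \<G>" "src \<G> a = x" "c a = h"
        by (auto simp: isotropy_at_def)
      then show "(x, h) \<in> ?f ` (topspace (arrow_top \<G>) \<inter> ?I)"
        by (intro image_eqI[of _ _ a]) (simp_all flip: arrows_def)
    qed
  qed
  show "inj_on ?f (topspace ?TI)"
  proof (rule inj_onI, unfold TI)
    \<comment> \<open>Equal sources put a and b in one isotropy group, where c separates
      them.\<close>
    fix a b assume a: "a \<in> ?I" and b: "b \<in> ?I" and eq: "?f a = ?f b"
    then have "a \<in> isotropy_at \<G> (src \<G> a)" "b \<in> isotropy_at \<G> (src \<G> a)" "src \<G> a \<in> units \<G>"
      using interior_isotropyD src_closed by (auto simp: isotropy_at_def)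
    then show "a = b" using inj eq by (auto simp: inj_on_def)
  qed
  show "open_map ?TI ?P ?f"
    unfolding open_map_def
  proof (intro allI impI)
    fix U assume U: "openin ?TI U"
    then have U': "openin (arrow_top \<G>) U" "U \<subseteq> ?I"
      using openin_interior_isotropy openin_open_subtopology by blast+
    \<comment> \<open>Cutting U along the levels of c makes each piece of the image a product of an
      open set of units with a point of the discrete space H.\<close>
    have "?f ` U = (\<Union>h\<in>H. src \<G> ` (U \<inter> interior_level h) \<times> {h})"
      using U'(2) cH by (auto simp: interior_level_def)
    moreover have "openin (unit_top \<G>) (src \<G> ` (U \<inter> interior_level h))" for h
      using local_homeomorphism_imp_open_map[OF local_homeomorphism_src] openin_interior_level U'(1)
      by (simp add: open_map_def openin_Int)
    ultimately show "openin ?P (?f ` U)"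
      by (auto intro!: openin_Union simp: openin_prod_Times_iff)
  qed
qed

text \<open>For isotropy arrows, composable means having the same source, which is composability in
  the bundle; multiplicativity is the cocycle identity. The inverse is a homomorphism because the
  map also reflects composability.\<close>

lemma topological_groupoid_iso_src_cocycle:
  assumes inj: "\<And>x. x \<in> units \<G> \<Longrightarrow> inj_on c (isotropy_at \<G> x)"
    and H: "\<And>x. x \<in> units \<G> \<Longrightarrow> c ` (interior_isotropy \<G> \<inter> isotropy_at \<G> x) = H"
    and sub: "subgroup H G"
  shows "topological_groupoid_iso (restrict_groupoid \<G> (interior_isotropy \<G>))
           (trivial_group_bundle (unit_top \<G>) (G\<lparr>carrier := H\<rparr>)) (\<lambda>a. (src \<G> a, c a))"
    (is "topological_groupoid_iso ?R ?B ?f")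
proof -
  let ?I = "interior_isotropy \<G>"
  have I_sub: "?I \<subseteq> arrows \<G>" using interior_isotropyD(1) by blast
  have R: "arrows ?R = ?I" "composable ?R = composable \<G> \<inter> ?I \<times> ?I" "gmult ?R = gmult \<G>"
    using I_sub by (auto simp: arrows_def composable_def restrict_groupoid_def)
  have "homeomorphic_map (arrow_top ?R) (arrow_top ?B) ?f"
    using homeomorphic_map_src_cocycle[OF inj H]
    by (simp add: restrict_groupoid_def trivial_group_bundle_def)
  then obtain g where fg: "homeomorphic_maps (arrow_top ?R) (arrow_top ?B) ?f g"
    using homeomorphic_map_maps by blast
  have cf: "continuous_map (arrow_top ?R) (arrow_top ?B) ?f"
    and cg: "continuous_map (arrow_top ?B) (arrow_top ?R) g"
    and gf': "\<forall>a \<in> arrows ?R. g (?f a) = a" and fg': "\<forall>p \<in> arrows ?B. ?f (g p) = p"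
    using fg by (simp_all add: homeomorphic_maps_def arrows_def)
  have f: "?f a \<in> arrows ?B" if "a \<in> ?I" for a
    using subsetD[OF continuous_map_image_subset_topspace[OF cf] imageI, of a] that
    unfolding arrows_def[symmetric] R(1) by blast
  have g: "g p \<in> ?I" "?f (g p) = p" if "p \<in> arrows ?B" for p
    using subsetD[OF continuous_map_image_subset_topspace[OF cg] imageI, of p] fg' that
    unfolding arrows_def[symmetric] R(1) by blast+
  have gf: "g (?f a) = a" if "a \<in> ?I" for a
    using gf' that unfolding R(1) by blast
  have f_comp: "(?f a, ?f b) \<in> composable ?B \<longleftrightarrow> (a, b) \<in> composable ?R"
    if "a \<in> ?I" "b \<in> ?I" for a b
  proof -
    have "(?f a, ?f b) \<in> composable ?B \<longleftrightarrow> src ?B (?f a) = rng ?B (?f b)"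
      using f[OF that(1)] f[OF that(2)] by (simp add: composable_def)
    also have "\<dots> \<longleftrightarrow> src \<G> a = src \<G> b" by (simp add: trivial_group_bundle_def)
    also have "\<dots> \<longleftrightarrow> (a, b) \<in> composable ?R"
      using that interior_isotropyD[OF that(1)] interior_isotropyD[OF that(2)]
      by (simp add: R composable_iff)
    finally show ?thesis .
  qed
  have f_mult: "?f (gmult \<G> a b) = gmult ?B (?f a) (?f b)" if "(a, b) \<in> composable ?R" for a b
  proof -
    have "(a, b) \<in> composable \<G>" "a \<in> ?I" "b \<in> ?I" using that R(2) by auto
    \<comment> \<open>The bundle product keeps the base point of the left factor, while s(ab) =
      s(b); they agree as s(a) = r(b) = s(b).\<close>
    then show ?thesis
      using interior_isotropyD(2)[of b] interior_isotropyD(2)[of a]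
      by (simp add: trivial_group_bundle_def src_mult cocycle_mult composable_iff)
  qed
  have "groupoid_hom ?R ?B ?f"
    unfolding groupoid_hom_def using f f_comp f_mult by (auto simp: R)
  moreover have "groupoid_hom ?B ?R g"
    unfolding groupoid_hom_def
  proof (intro conjI ballI, goal_cases)
    case 1
    show ?case using g(1) R(1) by auto
  next
    case (2 pq)
    obtain p q where pq: "pq = (p, q)" by (cases pq)
    have p: "p \<in> arrows ?B" and q: "q \<in> arrows ?B" and comp: "(p, q) \<in> composable ?B"
      using 2 pq by (auto simp: composable_def)
    have gc: "(g p, g q) \<in> composable ?R"
      using f_comp[OF g(1)[OF p] g(1)[OF q]] comp g(2)[OF p] g(2)[OF q] by simp
    \<comment> \<open>The product in the bundle is rewritten as the image under ?f of a product in
      the interior, which g then undoes.\<close>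
    have "g (gmult ?B p q) = g (?f (gmult \<G> (g p) (g q)))"
      using f_mult[OF gc] g(2)[OF p] g(2)[OF q] by simp
    also have "\<dots> = gmult \<G> (g p) (g q)"
      using gc R(2) interior_isotropy_mult by (intro gf) auto
    finally show ?case using gc by (simp add: pq R)
  qed
  ultimately show ?thesis
    unfolding topological_groupoid_iso_def
    using fg topological_groupoid_interior_isotropy
      topological_groupoid_trivial_group_bundle[OF subgroup_imp_group[OF sub]]
    by blast
qed

section \<open>Closedness of the interior of the isotropy\<close>

text \<open>The isotropy is the equalizer of range and source, hence closed when the units are
  Hausdorff. This keeps limits in the isotropy; injectivity of c then identifies each limit with an
  interior arrow.\<close>

lemma closedin_interior_isotropy:
  assumes haus: "Hausdorff_space (arrow_top \<G>)"
    and inj: "\<And>x. x \<in> units \<G> \<Longrightarrow> inj_on c (isotropy_at \<G> x)"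
    and const: "\<And>x y. x \<in> units \<G> \<Longrightarrow> y \<in> units \<G> \<Longrightarrow>
      c ` (interior_isotropy \<G> \<inter> isotropy_at \<G> x) = c ` (interior_isotropy \<G> \<inter> isotropy_at \<G> y)"
  shows "closedin (arrow_top \<G>) (interior_isotropy \<G>)"
proof -
  let ?T = "arrow_top \<G>"
  let ?I = "interior_isotropy \<G>"
  have I_sub: "?I \<subseteq> isotropy \<G>" using interior_isotropyD by (auto simp: isotropy_iff)
  have "Hausdorff_space (unit_top \<G>)"
    using haus by (simp add: unit_top_def Hausdorff_space_subtopology)
  then have "closedin ?T {a \<in> topspace ?T. rng \<G> a = src \<G> a}"
    using continuous_rng continuous_src by (rule closedin_continuous_maps_eq)
  moreover have "{a \<in> topspace ?T. rng \<G> a = src \<G> a} = isotropy \<G>"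
    by (auto simp: isotropy_iff arrows_def)
  ultimately have cl: "?T closure_of ?I \<subseteq> isotropy \<G>"
    using closure_of_minimal[OF I_sub] by simp
  have "?T closure_of ?I \<subseteq> ?I"
  proof
    fix a assume a: "a \<in> ?T closure_of ?I"
    then have aG: "a \<in> arrows \<G>" "rng \<G> a = src \<G> a" using cl isotropy_iff by blast+
    then have x: "src \<G> a \<in> units \<G>" by (simp add: src_closed)
    \<comment> \<open>By discreteness the level set of c through a is an open neighbourhood of a, so
      it meets the interior.\<close>
    have "openin ?T {b \<in> topspace ?T. c b \<in> {c a}}"
      using cocycle_closed[OF aG(1)]
      by (intro openin_continuous_map_preimage[OF continuous_cocycle]) auto
    moreover have "a \<in> {b \<in> topspace ?T. c b \<in> {c a}}" using aG by (simp add: arrows_def)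
    ultimately have "\<exists>b. b \<in> ?I \<and> b \<in> {b \<in> topspace ?T. c b \<in> {c a}}"
      using in_closure_of[THEN iffD1, OF a] by meson
    then obtain b where b: "b \<in> ?I" "c b = c a" by auto
    have "c a \<in> c ` (?I \<inter> isotropy_at \<G> (src \<G> b))"
      using b interior_isotropyD[OF b(1)]
      by (intro image_eqI[of _ _ b]) (simp_all add: isotropy_at_def)
    \<comment> \<open>The arrow b may sit over another unit; constancy of the image replaces it by
      an arrow d over s(a) with the same value.\<close>
    also have "\<dots> = c ` (?I \<inter> isotropy_at \<G> (src \<G> a))"
      using const x src_closed interior_isotropyD(1)[OF b(1)] by blast
    finally obtain d where "d \<in> ?I" "d \<in> isotropy_at \<G> (src \<G> a)" "c d = c a" by auto
    moreover have "a \<in> isotropy_at \<G> (src \<G> a)" using aG by (simp add: isotropy_at_def)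
    ultimately show "a \<in> ?I" using inj[OF x] by (metis inj_onD)
  qed
  moreover have "?I \<subseteq> topspace ?T" using interior_isotropyD(1) by (auto simp: arrows_def)
  ultimately show ?thesis by (simp add: closure_of_subset_eq[symmetric])
qed

end

theorem proposition2p1:
  fixes \<G> :: "'g groupoid_data" and G :: "('a, 'm) monoid_scheme" and c :: "'g \<Rightarrow> 'a"
  assumes "etale_groupoid \<G>"
    and "locally_compact_space (arrow_top \<G>)"
    and "Hausdorff_space (arrow_top \<G>)"
    and "comm_group G"
    and "countable (carrier G)"
    and "c \<in> continuous_cocycles \<G> (discrete_topology (carrier G)) G"
    and "minimal_groupoid \<G>"
    and "\<forall>x \<in> units \<G>. inj_on c (isotropy_at \<G> x)"
  shows "(\<forall>x \<in> units \<G>. \<forall>y \<in> units \<G>.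
            c ` (interior_isotropy \<G> \<inter> isotropy_at \<G> x) =
            c ` (interior_isotropy \<G> \<inter> isotropy_at \<G> y)) \<and>
         (\<forall>x \<in> units \<G>. \<forall>H. H = c ` (interior_isotropy \<G> \<inter> isotropy_at \<G> x) \<longrightarrow>
            subgroup H G \<and>
            topological_groupoid_iso
              (restrict_groupoid \<G> (interior_isotropy \<G>))
              (trivial_group_bundle (unit_top \<G>) (G\<lparr>carrier := H\<rparr>))
              (\<lambda>a. (src \<G> a, c a))) \<and>
         closedin (arrow_top \<G>) (interior_isotropy \<G>)"
proof -
  interpret etale_groupoid \<G> by fact
  interpret comm_group G by fact
  interpret cocycle_etale_groupoid \<G> G c by unfold_locales fact
  have inj: "inj_on c (isotropy_at \<G> x)" if "x \<in> units \<G>" for x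
    using assms(8) that by blast
  have const: "c ` (interior_isotropy \<G> \<inter> isotropy_at \<G> x) =
      c ` (interior_isotropy \<G> \<inter> isotropy_at \<G> y)" if "x \<in> units \<G>" "y \<in> units \<G>" for x y
    \<comment> \<open>The two inclusions are the same lemma with x and y exchanged.\<close>
    using that assms(7) by (intro equalityI cocycle_interior_fibre_subset)
  show ?thesis
  proof (intro conjI ballI allI impI)
    fix x H assume x: "x \<in> units \<G>" and H: "H = c ` (interior_isotropy \<G> \<inter> isotropy_at \<G> x)"
    show sub: "subgroup H G" unfolding H by (rule subgroup_cocycle_interior_fibre[OF x])
    show "topological_groupoid_iso (restrict_groupoid \<G> (interior_isotropy \<G>))
        (trivial_group_bundle (unit_top \<G>) (G\<lparr>carrier := H\<rparr>)) (\<lambda>a. (src \<G> a, c a))"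
      using const[OF _ x] H sub inj by (intro topological_groupoid_iso_src_cocycle) auto
  qed (use const closedin_interior_isotropy[OF assms(3) inj const] in blast)+
qed

end
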